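(* Up to isomorphism there are exactly $6$ simple connected graphs on $4$ vertices. Among them, the path $P_4$, the star $K_{1,3}$, and the triangle with one pendant edge attached do not allow the characteristic polynomial a square, while the cycle $C_4$, the graph obtained from the complete graph $K_4$ by deleting one edge, and the complete graph $K_4$ allow the characteristic polynomial a square.
   Context: For a simple undirected graph $G$ with vertex set $\{1,\ldots,n\}$, $S(G)$ is the set of all real symmetric $n\times n$ matrices $A=(a_{ij})$ such that, for $i\neq j$, $a_{ij}\neq 0$ if and only if $i$ and $j$ are adjacent in $G$ (diagonal entries are unrestricted). $G$ is said to allow the characteristic polynomial a square if there exists $A\in S(G)$ whose characteristic polynomial $\det(xI_n-A)$ equals $g(x)^2$ for some $g(x)\in\mathbb{R}[x]$; equivalently, all eigenvalues of $A$ have even multiplicity. *)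

theory Defs
  imports
    "Jordan_Normal_Form.Char_Poly"
    "Graph_Theory.Graph_Theory"
begin

text \<open>Simple undirected graphs are \<^locale>\<open>pair_graph\<close>s: an edge between i and j is represented
  by the two arcs (i,j) and (j,i).\<close>

definition simple_graphs :: "nat \<Rightarrow> nat pair_pre_digraph set" where
  "simple_graphs n = {G. pair_graph G \<and> pverts G = {1..n}}"

text \<open>The qualified name distinguishes graph connectedness from topological connectedness.\<close>

definition connected_graphs :: "nat \<Rightarrow> nat pair_pre_digraph set" where
  "connected_graphs n = {G \<in> simple_graphs n. Digraph_Component.connected (with_proj G)}"

definition graph_iso :: "nat pair_pre_digraph \<Rightarrow> nat pair_pre_digraph \<Rightarrow> bool" where
  "graph_iso G H \<longleftrightarrow> digraph_iso (with_proj G) (with_proj H)"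

definition iso_rel :: "nat \<Rightarrow> nat pair_pre_digraph rel" where
  "iso_rel n = {(G, H). G \<in> connected_graphs n \<and> H \<in> connected_graphs n \<and> graph_iso G H}"

text \<open>Matrix indices start at 0 and vertices at 1, whence the shift by \<^const>\<open>Suc\<close>.\<close>

definition sym_mats :: "nat \<Rightarrow> nat pair_pre_digraph \<Rightarrow> real mat set" where
  "sym_mats n G = {A \<in> carrier_mat n n. transpose_mat A = A \<and>
     (\<forall>i<n. \<forall>j<n. i \<noteq> j \<longrightarrow> (A $$ (i, j) \<noteq> 0 \<longleftrightarrow> (Suc i, Suc j) \<in> parcs G))}"

definition allows_char_poly_square :: "nat \<Rightarrow> nat pair_pre_digraph \<Rightarrow> bool" where
  "allows_char_poly_square n G \<longleftrightarrow> (\<exists>A \<in> sym_mats n G. \<exists>g :: real poly. char_poly A = g ^ 2)"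

definition graph_of_edges :: "nat \<Rightarrow> nat set set \<Rightarrow> nat pair_pre_digraph" where
  "graph_of_edges n E = \<lparr> pverts = {1..n}, parcs = {(i, j). {i, j} \<in> E} \<rparr>"

definition P4 :: "nat pair_pre_digraph" where
  "P4 = graph_of_edges 4 {{1, 2}, {2, 3}, {3, 4}}"

definition K13 :: "nat pair_pre_digraph" where
  "K13 = graph_of_edges 4 {{1, 2}, {1, 3}, {1, 4}}"

definition triangle_pendant :: "nat pair_pre_digraph" where
  "triangle_pendant = graph_of_edges 4 {{1, 2}, {2, 3}, {1, 3}, {3, 4}}"

definition C4 :: "nat pair_pre_digraph" where
  "C4 = graph_of_edges 4 {{1, 2}, {2, 3}, {3, 4}, {1, 4}}"

definition K4_minus_edge :: "nat pair_pre_digraph" where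
  "K4_minus_edge = graph_of_edges 4 ({e. e \<subseteq> {1..4} \<and> card e = 2} - {{1, 2}})"

definition K4 :: "nat pair_pre_digraph" where
  "K4 = graph_of_edges 4 {e. e \<subseteq> {1..4} \<and> card e = 2}"

end

theory Submission
  imports Defs
begin

text \<open>If A is real symmetric with characteristic polynomial \<open>g\<^sup>2\<close>, then \<open>g(A)\<close> is symmetric and
  squares to 0 by Cayley--Hamilton, so \<open>g(A) = 0\<close>. For four vertices g is quadratic, hence the
  off-diagonal zeros of A are zeros of \<open>A\<^sup>2\<close>, and two distinct non-adjacent vertices cannot have
  exactly one common neighbour. This rules out the path, the star and the triangle with a pendant
  edge; for the other three graphs there are explicit matrices with two double eigenvalues. The
  graphs are told apart by the number of arcs and the existence of a vertex adjacent to all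
  others.\<close>

section \<open>Isomorphism and connectedness\<close>

text \<open>The diagonal of A is free, so the obstruction must come from entries in which it
  cancels. For non-adjacent u and v, a product in the (u, v) entry of \<open>A * A\<close> that
  contains a diagonal entry also contains the zero at (u, v), so only common neighbours count. A
  single one leaves one nonzero product. Two of them can contribute opposite signs, and this is why
  the matrices for \<open>C4\<close> and \<open>K4_minus_edge\<close> have negative entries. In the
  latter the missing edge asks for orthogonal Gram vectors at the vertices 1 and 2, and the double
  eigenvalue asks for orthogonal columns of equal length: 25 + 4 + 4 = 1 + 16 + 16. Arguing with
  g(A) = 0 takes the place of diagonalisation: all that is used of symmetry over the reals is that a
  sum of squares vanishes only termwise.\<close>

lemma simple_graphs_iff:
  "G \<in> simple_graphs n \<longleftrightarrow> pverts G = {1..n} \<and> parcs G \<subseteq> {1..n} \<times> {1..n} \<and>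
     (\<forall>u v. (u, v) \<in> parcs G \<longrightarrow> u \<noteq> v \<and> (v, u) \<in> parcs G)"
proof
  assume "G \<in> simple_graphs n"
  then interpret pair_graph G by (simp add: simple_graphs_def)
  show "pverts G = {1..n} \<and> parcs G \<subseteq> {1..n} \<times> {1..n} \<and>
     (\<forall>u v. (u, v) \<in> parcs G \<longrightarrow> u \<noteq> v \<and> (v, u) \<in> parcs G)"
    using \<open>G \<in> simple_graphs n\<close> in_arcsD1 in_arcsD2 arcs_symmetric
    by (auto simp: simple_graphs_def dest: pair_no_loops)
next
  assume G: "pverts G = {1..n} \<and> parcs G \<subseteq> {1..n} \<times> {1..n} \<and>
     (\<forall>u v. (u, v) \<in> parcs G \<longrightarrow> u \<noteq> v \<and> (v, u) \<in> parcs G)"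
  then have "finite (parcs G)"
    using finite_subset by blast
  with G have "pair_graph G"
    by unfold_locales (auto simp: symmetric_def sym_def)
  with G show "G \<in> simple_graphs n"
    by (simp add: simple_graphs_def)
qed

text \<open>Without parallel arcs a vertex bijection determines the arc map, so the record of four
  maps behind \<open>digraph_iso\<close> reduces to one function. Both graphs live on the same
  vertex set, so the bijection is a self-map of it.\<close>

definition iso_map :: "nat \<Rightarrow> (nat \<Rightarrow> nat) \<Rightarrow> nat pair_pre_digraph \<Rightarrow> nat pair_pre_digraph \<Rightarrow> bool" where
  "iso_map n f G H \<longleftrightarrow> bij_betw f {1..n} {1..n} \<and>
    (\<forall>u\<in>{1..n}. \<forall>v\<in>{1..n}. (u, v) \<in> parcs G \<longleftrightarrow> (f u, f v) \<in> parcs H)"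

lemma iso_map_arc:
  "iso_map n f G H \<Longrightarrow> u \<in> {1..n} \<Longrightarrow> v \<in> {1..n} \<Longrightarrow> (f u, f v) \<in> parcs H \<longleftrightarrow> (u, v) \<in> parcs G"
  unfolding iso_map_def by blast

lemma iso_map_bij: "iso_map n f G H \<Longrightarrow> bij_betw f {1..n} {1..n}"
  by (simp add: iso_map_def)

lemma iso_map_inverse:
  assumes "iso_map n f G H"
  shows "iso_map n (the_inv_into {1..n} f) H G"
proof -
  let ?g = "the_inv_into {1..n} f"
  note f = iso_map_bij[OF assms]
  then have g: "bij_betw ?g {1..n} {1..n}"
    by (rule bij_betw_the_inv_into)
  have "(u, v) \<in> parcs H \<longleftrightarrow> (?g u, ?g v) \<in> parcs G" if "u \<in> {1..n}" "v \<in> {1..n}" for u v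
    using iso_map_arc[OF assms bij_betwE[OF g, rule_format, OF that(1)] bij_betwE[OF g, rule_format, OF that(2)]]
    by (simp only: f_the_inv_into_f_bij_betw[OF f that(1)] f_the_inv_into_f_bij_betw[OF f that(2)])
  with g show ?thesis
    unfolding iso_map_def by simp
qed

lemma iso_map_comp:
  assumes f: "iso_map n f G H" and g: "iso_map n g H K"
  shows "iso_map n (g \<circ> f) G K"
proof -
  have "bij_betw (g \<circ> f) {1..n} {1..n}"
    using iso_map_bij[OF f] iso_map_bij[OF g] by (rule bij_betw_trans)
  moreover have "(u, v) \<in> parcs G \<longleftrightarrow> ((g \<circ> f) u, (g \<circ> f) v) \<in> parcs K"
    if "u \<in> {1..n}" "v \<in> {1..n}" for u v
    using iso_map_arc[OF f that] iso_map_arc[OF g, of "f u" "f v"] that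
      bij_betwE[OF iso_map_bij[OF f]] by simp
  ultimately show ?thesis
    unfolding iso_map_def by simp
qed

lemma graph_iso_iff:
  assumes G: "G \<in> simple_graphs n" and H: "H \<in> simple_graphs n"
  shows "graph_iso G H \<longleftrightarrow> (\<exists>f. iso_map n f G H)"
    (is "_ \<longleftrightarrow> ?rhs")
proof
  interpret pair_graph G using G by (simp add: simple_graphs_def)
  assume "graph_iso G H"
  then obtain h where h: "digraph_isomorphism h" "with_proj H = app_iso h (with_proj G)"
    unfolding graph_iso_def digraph_iso_def by blast
  let ?f = "iso_verts h"
  have inj: "inj_on ?f {1..n}"
    using h(1) G by (auto simp: digraph_isomorphism_def simple_graphs_iff)
  \<comment> \<open>Since the image under \<open>h\<close> is a \<open>with_proj\<close> graph, its
    tail and head maps are the projections. Hence \<open>iso_arcs h\<close> acts on arcs as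
    \<open>?f\<close> on both components.\<close>
  have vH: "pverts H = ?f ` pverts G" and tl: "iso_tail h = fst" "iso_head h = snd"
    and aH: "parcs H = iso_arcs h ` parcs G"
    using h(2) by (auto simp: with_proj_def app_iso_def)
  have "iso_arcs h a = (?f (fst a), ?f (snd a))" if "a \<in> parcs G" for a
    using h(1) that tl by (auto simp: digraph_isomorphism_def intro: prod_eqI)
  then have pH: "parcs H = (\<lambda>a. (?f (fst a), ?f (snd a))) ` parcs G"
    using aH by auto
  have arcs: "(u, v) \<in> parcs G \<longleftrightarrow> (?f u, ?f v) \<in> parcs H" if "u \<in> {1..n}" "v \<in> {1..n}" for u v
  proof
    assume "(?f u, ?f v) \<in> parcs H"
    then obtain a where "a \<in> parcs G" "?f u = ?f (fst a)" "?f v = ?f (snd a)"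
      using pH by auto
    moreover have "fst a \<in> {1..n}" "snd a \<in> {1..n}"
      using \<open>a \<in> parcs G\<close> G by (auto simp: simple_graphs_iff)
    ultimately show "(u, v) \<in> parcs G"
      using that inj by (metis inj_onD prod.collapse)
  qed (use pH in force)
  have "bij_betw ?f {1..n} {1..n}"
    using inj vH G H by (auto simp: bij_betw_def simple_graphs_iff)
  with arcs have "iso_map n ?f G H" by (simp add: iso_map_def)
  then show ?rhs by blast
next
  interpret pair_graph G using G by (simp add: simple_graphs_def)
  assume ?rhs
  then obtain f where iso: "iso_map n f G H" ..
  note f = iso_map_bij[OF iso] and arcs = iso_map_arc[OF iso]
  let ?h = "\<lparr>iso_verts = f, iso_arcs = (\<lambda>(u, v). (f u, f v)), iso_head = snd, iso_tail = fst\<rparr>"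
  have inj: "inj_on f {1..n}" and img: "f ` {1..n} = {1..n}"
    using f by (auto simp: bij_betw_def)
  have sub: "parcs G \<subseteq> {1..n} \<times> {1..n}" "parcs H \<subseteq> {1..n} \<times> {1..n}" "pverts G = {1..n}" "pverts H = {1..n}"
    using G H by (auto simp: simple_graphs_iff)
  have "inj_on (\<lambda>(u, v). (f u, f v)) (parcs G)"
  proof (rule inj_onI, clarify)
    fix u v u' v' assume "(u, v) \<in> parcs G" "(u', v') \<in> parcs G" "f u = f u'" "f v = f v'"
    moreover from this sub(1) have "u \<in> {1..n}" "v \<in> {1..n}" "u' \<in> {1..n}" "v' \<in> {1..n}"
      by blast+
    ultimately show "u = u' \<and> v = v'" using inj_onD[OF inj] by simp
  qed
  then have "digraph_isomorphism ?h"
    unfolding digraph_isomorphism_def using inj sub(3) wf_digraph_axioms by (simp add: split_beta)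
  moreover have "(\<lambda>(u, v). (f u, f v)) ` parcs G = parcs H"
  proof (rule equalityI; clarify)
    fix u v assume "(u, v) \<in> parcs G"
    then show "(f u, f v) \<in> parcs H" using arcs[of u v] sub(1) by auto
  next
    fix x y assume xy: "(x, y) \<in> parcs H"
    with sub(2) have "x \<in> f ` {1..n}" "y \<in> f ` {1..n}"
      unfolding img by blast+
    then obtain u v where "u \<in> {1..n}" "v \<in> {1..n}" "x = f u" "y = f v"
      by (elim imageE)
    with xy show "(x, y) \<in> (\<lambda>(u, v). (f u, f v)) ` parcs G"
      using arcs[of u v] by (intro image_eqI[of _ _ "(u, v)"]) simp_all
  qed
  then have "with_proj H = app_iso ?h (with_proj G)"
    by (simp add: with_proj_def app_iso_def sub(3,4) img[unfolded One_nat_def])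
  ultimately show "graph_iso G H"
    unfolding graph_iso_def digraph_iso_def by blast
qed

section \<open>Isomorphism as an equivalence relation, and connectedness\<close>

lemma graph_iso_refl: "G \<in> simple_graphs n \<Longrightarrow> graph_iso G G"
  unfolding graph_iso_iff[of G n G] by (rule exI[of _ id]) (simp add: iso_map_def)

lemma graph_iso_sym:
  assumes "G \<in> simple_graphs n" "H \<in> simple_graphs n" "graph_iso G H"
  shows "graph_iso H G"
  using assms iso_map_inverse by (metis graph_iso_iff)

lemma graph_iso_trans:
  assumes "G \<in> simple_graphs n" "H \<in> simple_graphs n" "K \<in> simple_graphs n"
    and "graph_iso G H" "graph_iso H K"
  shows "graph_iso G K"
  using assms iso_map_comp by (metis graph_iso_iff)

lemma equiv_iso_rel: "equiv (connected_graphs n) (iso_rel n)"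
proof (rule equivI)
  show "iso_rel n \<subseteq> connected_graphs n \<times> connected_graphs n"
    by (auto simp: iso_rel_def)
  show "refl_on (connected_graphs n) (iso_rel n)"
    by (auto simp: refl_on_def iso_rel_def connected_graphs_def intro: graph_iso_refl)
  show "sym (iso_rel n)"
    by (auto simp: sym_def iso_rel_def connected_graphs_def dest: graph_iso_sym)
  show "trans (iso_rel n)"
    unfolding trans_def iso_rel_def connected_graphs_def
    by (auto dest: graph_iso_trans[rotated 3])
qed

text \<open>Library connectedness is strong connectedness of the symmetrised graph, with
  reachability confined to the vertex set. The arcs are already symmetric and never leave {1..n}, so
  the plain closure describes it. The bound on n excludes the empty graph, which is not strongly
  connected.\<close>

lemma connected_graphs_iff:
  assumes G: "G \<in> simple_graphs n" and n: "n \<ge> 1"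
  shows "G \<in> connected_graphs n \<longleftrightarrow>
    (\<forall>u\<in>{1..n}. \<forall>v\<in>{1..n}. (u, v) \<in> (parcs G)\<^sup>*)"
proof -
  have sub: "parcs G \<subseteq> {1..n} \<times> {1..n}" "pverts G = {1..n}"
    and sym: "\<And>u v. (u, v) \<in> parcs G \<Longrightarrow> (v, u) \<in> parcs G"
    using G by (auto simp: simple_graphs_iff)
  have "mk_symmetric (with_proj G) = G"
  proof -
    have "(\<Union>e\<in>parcs G. {(fst e, snd e), (snd e, fst e)}) = parcs G"
      using sym by force
    then show ?thesis by (simp add: mk_symmetric_def)
  qed
  moreover have "(u, v) \<in> rtrancl_on {1..n} (parcs G) \<longleftrightarrow> (u, v) \<in> (parcs G)\<^sup>*"
    if "u \<in> {1..n}" for u v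
  proof
    assume "(u, v) \<in> rtrancl_on {1..n} (parcs G)"
    then show "(u, v) \<in> (parcs G)\<^sup>*"
      by induction auto
  next
    assume "(u, v) \<in> (parcs G)\<^sup>*"
    then show "(u, v) \<in> rtrancl_on {1..n} (parcs G)"
      by induction (use that sub in \<open>auto intro: rtrancl_on_into_rtrancl_on\<close>)
  qed
  ultimately show ?thesis
    using G n by (auto simp: connected_graphs_def connected_def strongly_connected_def
        reachable_def sub)
qed

lemma connected_graphsI:
  assumes G: "G \<in> simple_graphs n" and r: "r \<in> {1..n}"
    and reach: "\<And>v. v \<in> {1..n} \<Longrightarrow> (r, v) \<in> (parcs G)\<^sup>*"
  shows "G \<in> connected_graphs n"
proof -
  have "sym (parcs G)"
    using G by (auto simp: simple_graphs_iff intro: symI)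
  then have "sym ((parcs G)\<^sup>*)"
    by (rule sym_rtrancl)
  then have "(u, v) \<in> (parcs G)\<^sup>*" if "u \<in> {1..n}" "v \<in> {1..n}" for u v
    using that reach by (meson rtrancl_trans symD)
  then show ?thesis
    using connected_graphs_iff[OF G] r by auto
qed

text \<open>A set that no arc leaves contains everything reachable from it. In this form
  connectedness becomes a clause about single edges, as the classification requires.\<close>

lemma connected_graphs_cut:
  assumes "G \<in> connected_graphs n" and "S \<subseteq> {1..n}" "S \<noteq> {}" "S \<noteq> {1..n}"
  shows "\<exists>u\<in>S. \<exists>v\<in>{1..n} - S. (u, v) \<in> parcs G"
proof (rule ccontr)
  have G: "G \<in> simple_graphs n" using assms(1) by (simp add: connected_graphs_def)
  assume no: "\<not> ?thesis"
  obtain u v where u: "u \<in> S" and v: "v \<in> {1..n} - S"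
    using assms by blast
  have "n \<ge> 1" using v by auto
  then have "(u, v) \<in> (parcs G)\<^sup>*"
    using connected_graphs_iff[OF G] assms u v by blast
  then have "v \<in> S"
    by induction (use u no G in \<open>auto simp: simple_graphs_iff\<close>)
  with v show False by simp
qed

section \<open>Isomorphism invariants\<close>

lemma graph_iso_card_parcs:
  assumes G: "G \<in> simple_graphs n" and H: "H \<in> simple_graphs n" and "graph_iso G H"
  shows "card (parcs G) = card (parcs H)"
proof -
  \<comment> \<open>One inequality is enough: it is applied to an isomorphism and to its
    inverse.\<close>
  have le: "card (parcs G) \<le> card (parcs H)"
    if G: "G \<in> simple_graphs n" and H: "H \<in> simple_graphs n" and f: "iso_map n f G H" for f G H
  proof (rule card_inj_on_le)
    have sub: "parcs G \<subseteq> {1..n} \<times> {1..n}" "parcs H \<subseteq> {1..n} \<times> {1..n}"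
      using G H by (auto simp: simple_graphs_iff)
    have "inj_on (map_prod f f) ({1..n} \<times> {1..n})"
      using iso_map_bij[OF f] by (intro map_prod_inj_on) (auto simp: bij_betw_def)
    then show "inj_on (map_prod f f) (parcs G)"
      using sub(1) by (rule inj_on_subset)
    show "map_prod f f ` parcs G \<subseteq> parcs H"
    proof (rule image_subsetI)
      fix a assume "a \<in> parcs G"
      then show "map_prod f f a \<in> parcs H"
        using iso_map_arc[OF f, of "fst a" "snd a"] sub(1) by (cases a) auto
    qed
    show "finite (parcs H)"
      using sub(2) by (rule finite_subset) simp
  qed
  obtain f where "iso_map n f G H"
    using assms(3) graph_iso_iff[OF G H] by blast
  with le[OF G H] le[OF H G] iso_map_inverse show ?thesis
    by (metis le_antisym)
qed

text \<open>This breaks the two ties in the number of arcs: \<open>P4\<close> against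
  \<open>K13\<close> with 6 arcs, and \<open>C4\<close> against \<open>triangle_pendant\<close> with
  8.\<close>

definition dominated :: "nat \<Rightarrow> nat pair_pre_digraph \<Rightarrow> bool" where
  "dominated n G \<longleftrightarrow> (\<exists>u\<in>{1..n}. \<forall>v\<in>{1..n}. v \<noteq> u \<longrightarrow> (u, v) \<in> parcs G)"

lemma graph_iso_dominated:
  assumes G: "G \<in> simple_graphs n" and H: "H \<in> simple_graphs n" and "graph_iso G H"
    and "dominated n G"
  shows "dominated n H"
proof -
  obtain f where f: "iso_map n f G H"
    using assms(3) graph_iso_iff[OF G H] by blast
  obtain u where u: "u \<in> {1..n}" and arcs: "\<And>v. v \<in> {1..n} \<Longrightarrow> v \<noteq> u \<Longrightarrow> (u, v) \<in> parcs G"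
    using assms(4) by (auto simp: dominated_def)
  have "(f u, v) \<in> parcs H" if "v \<in> {1..n}" "v \<noteq> f u" for v
  proof -
    have "v \<in> f ` {1..n}"
      using that(1) iso_map_bij[OF f] by (simp only: bij_betw_imp_surj_on)
    then obtain v' where "v' \<in> {1..n}" "v = f v'" ..
    then show ?thesis
      using that(2) u arcs[of v'] iso_map_arc[OF f u, of v'] by auto
  qed
  moreover have "f u \<in> {1..n}"
    using u bij_betwE[OF iso_map_bij[OF f]] by blast
  ultimately show ?thesis
    unfolding dominated_def by blast
qed

section \<open>Characteristic polynomials that are squares\<close>

definition mat_eval :: "'a :: comm_ring_1 mat \<Rightarrow> 'a poly \<Rightarrow> 'a mat" where
  "mat_eval A p = fold_coeffs (\<lambda>a X. a \<cdot>\<^sub>m 1\<^sub>m (dim_row A) + A * X) p (0\<^sub>m (dim_row A) (dim_row A))"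

lemma mat_eval_0: "A \<in> carrier_mat n n \<Longrightarrow> mat_eval A 0 = 0\<^sub>m n n"
  by (simp add: mat_eval_def)

text \<open>Matrices of all sizes share one type, which is therefore not a ring, so evaluation is a
  Horner fold with the size read off A. The fold skips the step for \<open>pCons 0 0\<close>; the
  equation survives because a Horner step with coefficient 0 sends the zero matrix to
  itself.\<close>

lemma mat_eval_pCons:
  assumes A: "A \<in> carrier_mat n n"
  shows "mat_eval A (pCons a p) = a \<cdot>\<^sub>m 1\<^sub>m n + A * mat_eval A p"
proof (cases "a = 0 \<and> p = 0")
  case True
  have "0 \<cdot>\<^sub>m 1\<^sub>m n + A * 0\<^sub>m n n = 0\<^sub>m n n"
    using A by (intro eq_matI) auto
  with True A show ?thesis by (simp add: mat_eval_0)
next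
  case False
  then show ?thesis
    using A by (auto simp: mat_eval_def)
qed

lemma mat_eval_carrier:
  assumes A: "A \<in> carrier_mat n n"
  shows "mat_eval A p \<in> carrier_mat n n"
  by (induction p) (use A in \<open>simp_all add: mat_eval_0[OF A] mat_eval_pCons[OF A]\<close>)

lemma mat_eval_add:
  assumes A: "A \<in> carrier_mat n n"
  shows "mat_eval A (p + q) = mat_eval A p + mat_eval A q"
proof (induction p q rule: poly_induct2)
  case 0
  then show ?case using A by (simp add: mat_eval_0)
next
  case (pCons a p b q)
  let ?P = "mat_eval A p" and ?Q = "mat_eval A q"
  have c: "?P \<in> carrier_mat n n" "?Q \<in> carrier_mat n n"
    using mat_eval_carrier[OF A] by auto
  have "mat_eval A (pCons a p + pCons b q) = (a + b) \<cdot>\<^sub>m 1\<^sub>m n + A * (?P + ?Q)"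
    by (simp add: mat_eval_pCons[OF A] pCons.IH)
  also have "A * (?P + ?Q) = A * ?P + A * ?Q"
    by (rule mult_add_distrib_mat[OF A c])
  also have "(a + b) \<cdot>\<^sub>m 1\<^sub>m n + (A * ?P + A * ?Q) = (a \<cdot>\<^sub>m 1\<^sub>m n + A * ?P) + (b \<cdot>\<^sub>m 1\<^sub>m n + A * ?Q)"
    using A c by (intro eq_matI) (auto simp: algebra_simps)
  finally show ?case
    by (simp add: mat_eval_pCons[OF A])
qed

lemma mat_eval_smult:
  assumes A: "A \<in> carrier_mat n n"
  shows "mat_eval A (Polynomial.smult c p) = c \<cdot>\<^sub>m mat_eval A p"
proof (induction p)
  case 0
  then show ?case using A by (simp add: mat_eval_0)
next
  case (pCons a p)
  let ?P = "mat_eval A p"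
  have P: "?P \<in> carrier_mat n n" by (rule mat_eval_carrier[OF A])
  have "mat_eval A (Polynomial.smult c (pCons a p)) = (c * a) \<cdot>\<^sub>m 1\<^sub>m n + A * (c \<cdot>\<^sub>m ?P)"
    by (simp add: mat_eval_pCons[OF A] pCons.IH)
  also have "A * (c \<cdot>\<^sub>m ?P) = c \<cdot>\<^sub>m (A * ?P)"
    by (rule mult_smult_distrib[OF A P])
  also have "(c * a) \<cdot>\<^sub>m 1\<^sub>m n + c \<cdot>\<^sub>m (A * ?P) = c \<cdot>\<^sub>m (a \<cdot>\<^sub>m 1\<^sub>m n + A * ?P)"
    using A P by (intro eq_matI) (auto simp: algebra_simps)
  finally show ?case
    by (simp add: mat_eval_pCons[OF A])
qed

lemma mat_eval_mult:
  assumes A: "A \<in> carrier_mat n n"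
  shows "mat_eval A (p * q) = mat_eval A p * mat_eval A q"
proof (induction p)
  case 0
  then show ?case using A mat_eval_carrier[OF A, of q] by (simp add: mat_eval_0)
next
  case (pCons a p)
  let ?P = "mat_eval A p" and ?Q = "mat_eval A q"
  have c: "?P \<in> carrier_mat n n" "?Q \<in> carrier_mat n n"
    using mat_eval_carrier[OF A] by auto
  have "mat_eval A (pCons a p * q) = a \<cdot>\<^sub>m ?Q + (0 \<cdot>\<^sub>m 1\<^sub>m n + A * (?P * ?Q))"
    by (simp add: mat_eval_add[OF A] mat_eval_smult[OF A] mat_eval_pCons[OF A] pCons.IH)
  also have "0 \<cdot>\<^sub>m 1\<^sub>m n + A * (?P * ?Q) = A * ?P * ?Q"
    using A c by (simp add: assoc_mult_mat[OF A c]) (intro eq_matI; auto)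
  also have "a \<cdot>\<^sub>m ?Q = a \<cdot>\<^sub>m 1\<^sub>m n * ?Q"
    using c by (simp add: mult_smult_assoc_mat[of _ n n])
  also have "a \<cdot>\<^sub>m 1\<^sub>m n * ?Q + A * ?P * ?Q = (a \<cdot>\<^sub>m 1\<^sub>m n + A * ?P) * ?Q"
    using A c by (subst add_mult_distrib_mat[of _ n n]) auto
  finally show ?case
    by (simp add: mat_eval_pCons[OF A])
qed

text \<open>The values at A of these shifted polynomials are the intermediate results of Horner's
  scheme.\<close>

lemma poly_shift_unfold: "poly_shift k p = pCons (coeff p k) (poly_shift (Suc k) p)"
  by (rule poly_eqI) (simp add: coeff_poly_shift coeff_pCons split: nat.split)

lemma cayley_hamilton:
  fixes A :: "'a :: comm_ring_1 mat"
  assumes A: "A \<in> carrier_mat n n"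
  shows "mat_eval A (char_poly A) = 0\<^sub>m n n"
proof -
  let ?p = "char_poly A"
  define M where "M = char_poly_matrix A"
  define S where "S = adj_mat M"
  have M: "M \<in> carrier_mat n n"
    using A by (simp add: M_def)
  have S: "S \<in> carrier_mat n n" and MS: "M * S = ?p \<cdot>\<^sub>m 1\<^sub>m n"
    using adj_mat(1,2)[OF M] by (auto simp: S_def M_def char_poly_def)
  \<comment> \<open>\<open>T k\<close> is the coefficient matrix of \<open>x\<^sup>k\<close> in the adjugate S of \<open>x I - A\<close>; comparing coefficients
    in \<open>(x I - A) S = p I\<close> gives Horner's scheme for \<open>p(A)\<close>, read from the top degree down.\<close>
  define T where "T k = mat n n (\<lambda>(i, j). coeff (S $$ (i, j)) k)" for k
  have T: "T k \<in> carrier_mat n n" for k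
    by (simp add: T_def)
  \<comment> \<open>Entry (i, j) of \<open>M * S\<close>, with the x on the diagonal of M turned
    into \<open>pCons 0\<close>. The coefficients of this polynomial identity drive the recursion
    below.\<close>
  have entry: "pCons 0 (S $$ (i, j)) - (\<Sum>l = 0..<n. Polynomial.smult (A $$ (i, l)) (S $$ (l, j)))
      = (if i = j then ?p else 0)" if ij: "i < n" "j < n" for i j
  proof -
    have "(\<Sum>l = 0..<n. M $$ (i, l) * S $$ (l, j)) = (M * S) $$ (i, j)"
      using ij M S by (simp add: scalar_prod_def)
    also have "\<dots> = (if i = j then ?p else 0)"
      using ij by (simp add: MS)
    finally have "(\<Sum>l = 0..<n. M $$ (i, l) * S $$ (l, j)) = (if i = j then ?p else 0)" .
    moreover have "M $$ (i, l) * S $$ (l, j) =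
        (if l = i then pCons 0 (S $$ (i, j)) else 0) - Polynomial.smult (A $$ (i, l)) (S $$ (l, j))"
      if "l < n" for l
      using ij that A by (simp add: M_def char_poly_matrix_def)
    ultimately show ?thesis
      using ij by (simp add: sum_subtractf)
  qed
  have AT: "(A * T k) $$ (i, j) = (\<Sum>l = 0..<n. A $$ (i, l) * coeff (S $$ (l, j)) k)"
    if "i < n" "j < n" for i j k
    using that A by (simp add: T_def scalar_prod_def)
  have T_Suc: "T k = coeff ?p (Suc k) \<cdot>\<^sub>m 1\<^sub>m n + A * T (Suc k)" for k
  proof (rule eq_matI)
    fix i j assume "i < dim_row (coeff ?p (Suc k) \<cdot>\<^sub>m 1\<^sub>m n + A * T (Suc k))"
      "j < dim_col (coeff ?p (Suc k) \<cdot>\<^sub>m 1\<^sub>m n + A * T (Suc k))"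
    then have ij: "i < n" "j < n"
      using A by (auto simp: T_def)
    show "T k $$ (i, j) = (coeff ?p (Suc k) \<cdot>\<^sub>m 1\<^sub>m n + A * T (Suc k)) $$ (i, j)"
      using arg_cong[OF entry[OF ij], of "\<lambda>q. coeff q (Suc k)"] AT[OF ij, of "Suc k"] ij A T[of "Suc k"]
      by (simp add: T_def coeff_sum algebra_simps split: if_splits)
  qed (use A in \<open>auto simp: T_def\<close>)
  \<comment> \<open>In degree 0 the shifted term x S contributes nothing. So the last Horner step
    yields zero, and its value is p(A).\<close>
  have T_0: "coeff ?p 0 \<cdot>\<^sub>m 1\<^sub>m n + A * T 0 = 0\<^sub>m n n"
  proof (rule eq_matI)
    fix i j assume "i < dim_row (0\<^sub>m n n)" "j < dim_col (0\<^sub>m n n)"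
    then have ij: "i < n" "j < n"
      by auto
    show "(coeff ?p 0 \<cdot>\<^sub>m 1\<^sub>m n + A * T 0) $$ (i, j) = 0\<^sub>m n n $$ (i, j)"
      using arg_cong[OF entry[OF ij], of "\<lambda>q. coeff q 0"] AT[OF ij, of 0] ij A T[of 0]
      by (simp add: coeff_sum eq_neg_iff_add_eq_0[symmetric] split: if_splits)
  qed (use A T[of 0] in auto)
  \<comment> \<open>A crude bound that dominates the degree of p and of every entry of S. From K on,
    both sides of the next claim are zero, which starts the downward induction. A sum, unlike a
    maximum, also makes sense for n = 0.\<close>
  define K where "K = degree ?p + (\<Sum>i<n. \<Sum>j<n. Suc (degree (S $$ (i, j))))"
  have "T k = mat_eval A (poly_shift (Suc k) ?p)" for k
  proof (induction "K - k" arbitrary: k)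
    case 0
    have "coeff (S $$ (i, j)) k = 0" if "i < n" "j < n" for i j
    proof (rule coeff_eq_0)
      have "degree (S $$ (i, j)) < Suc (degree (S $$ (i, j)))" by simp
      also have "\<dots> \<le> (\<Sum>j<n. Suc (degree (S $$ (i, j))))"
        using that by (intro member_le_sum) auto
      also have "\<dots> \<le> (\<Sum>i<n. \<Sum>j<n. Suc (degree (S $$ (i, j))))"
        using that by (intro member_le_sum[of i _ "\<lambda>i. \<Sum>j<n. Suc (degree (S $$ (i, j)))"]) auto
      finally show "degree (S $$ (i, j)) < k"
        using 0 by (simp add: K_def)
    qed
    then have "T k = 0\<^sub>m n n"
      by (intro eq_matI) (auto simp: T_def)
    moreover have "poly_shift (Suc k) ?p = 0"
      using 0 by (intro poly_eqI) (simp add: coeff_poly_shift K_def coeff_eq_0)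
    ultimately show ?case
      by (simp add: mat_eval_0[OF A])
  next
    case (Suc m)
    then have "T (Suc k) = mat_eval A (poly_shift (Suc (Suc k)) ?p)"
      by simp
    then show ?case
      by (simp add: T_Suc[of k] poly_shift_unfold[of "Suc k"] mat_eval_pCons[OF A])
  qed
  then have "mat_eval A (poly_shift 0 ?p) = coeff ?p 0 \<cdot>\<^sub>m 1\<^sub>m n + A * T 0"
    by (subst poly_shift_unfold) (simp add: mat_eval_pCons[OF A])
  then show ?thesis
    by (simp add: T_0 poly_shift_0)
qed

text \<open>Transposition reverses \<open>A * mat_eval A p\<close>, so the induction needs a matrix
  to commute with its own polynomials. That follows from commutativity of polynomial multiplication
  with the factor x.\<close>

lemma transpose_mat_eval:
  assumes A: "A \<in> carrier_mat n n"
  shows "transpose_mat (mat_eval A p) = mat_eval (transpose_mat A) p"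
proof (induction p)
  case 0
  then show ?case using A by (simp add: mat_eval_0[of _ n])
next
  case (pCons a p)
  have At: "transpose_mat A \<in> carrier_mat n n" using A by simp
  have c: "mat_eval A p \<in> carrier_mat n n" "mat_eval (transpose_mat A) p \<in> carrier_mat n n"
    using mat_eval_carrier A At by blast+
  have comm: "mat_eval B p * B = B * mat_eval B p" if B: "B \<in> carrier_mat n n" for B :: "'a mat"
  proof -
    have x: "mat_eval B [:0, 1:] = B"
      using B by (simp add: mat_eval_pCons[OF B] mat_eval_0[OF B]) (intro eq_matI; auto)
    show ?thesis
      using mat_eval_mult[OF B, of p "[:0, 1:]"] mat_eval_mult[OF B, of "[:0, 1:]" p]
      by (simp add: x mult.commute)
  qed
  have "transpose_mat (mat_eval A (pCons a p)) = a \<cdot>\<^sub>m 1\<^sub>m n + transpose_mat (A * mat_eval A p)"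
    using A c by (simp add: mat_eval_pCons[OF A] transpose_add[of _ n n]) (intro eq_matI; auto)
  also have "transpose_mat (A * mat_eval A p) = transpose_mat A * mat_eval (transpose_mat A) p"
    using transpose_mult[OF A c(1)] pCons.IH comm[OF At] by simp
  finally show ?case
    by (simp add: mat_eval_pCons[OF At])
qed

text \<open>For symmetric N the diagonal entries of \<open>N * N\<close> are the squared lengths of
  its rows.\<close>

lemma symmetric_mat_square_eq_0:
  fixes N :: "real mat"
  assumes N: "N \<in> carrier_mat n n" and sym: "transpose_mat N = N" and sq: "N * N = 0\<^sub>m n n"
  shows "N = 0\<^sub>m n n"
proof (rule eq_matI)
  fix i j assume "i < dim_row (0\<^sub>m n n :: real mat)" "j < dim_col (0\<^sub>m n n :: real mat)"
  then have ij: "i < n" "j < n" by auto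
  have flip: "N $$ (l, i) = N $$ (i, l)" if "l < n" for l
    using arg_cong[OF sym, of "\<lambda>X. X $$ (i, l)"] N ij that by simp
  have "(\<Sum>l = 0..<n. (N $$ (i, l))\<^sup>2) = (\<Sum>l = 0..<n. N $$ (i, l) * N $$ (l, i))"
    by (simp add: flip power2_eq_square)
  also have "\<dots> = (N * N) $$ (i, i)"
    using N ij by (simp add: scalar_prod_def)
  also have "\<dots> = 0"
    using sq ij by simp
  finally have "(\<Sum>l = 0..<n. (N $$ (i, l))\<^sup>2) = 0" .
  then show "N $$ (i, j) = 0\<^sub>m n n $$ (i, j)"
    using ij by (simp add: sum_nonneg_eq_0_iff)
qed (use N in auto)

lemma symmetric_char_poly_square:
  fixes A :: "real mat"
  assumes A: "A \<in> carrier_mat n n" and sym: "transpose_mat A = A" and g: "char_poly A = g\<^sup>2"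
  shows "mat_eval A g = 0\<^sub>m n n"
proof (rule symmetric_mat_square_eq_0)
  show "mat_eval A g \<in> carrier_mat n n" by (rule mat_eval_carrier[OF A])
  show "transpose_mat (mat_eval A g) = mat_eval A g"
    by (simp add: transpose_mat_eval[OF A] sym)
  show "mat_eval A g * mat_eval A g = 0\<^sub>m n n"
    using cayley_hamilton[OF A] by (simp add: g power2_eq_square mat_eval_mult[OF A])
qed

section \<open>The obstruction, and invariance under relabelling\<close>

lemma not_allows_char_poly_square:
  assumes G: "G \<in> simple_graphs 4"
    and ij: "i \<noteq> j" "(i, j) \<notin> parcs G"
    and verts: "i \<in> {1..4}" "j \<in> {1..4}" "k \<in> {1..4}"
    and k: "\<And>l. (i, l) \<in> parcs G \<and> (l, j) \<in> parcs G \<longleftrightarrow> l = k"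
  shows "\<not> allows_char_poly_square 4 G"
proof
  assume "allows_char_poly_square 4 G"
  then obtain A g where AG: "A \<in> sym_mats 4 G" and g: "char_poly A = g\<^sup>2"
    by (auto simp: allows_char_poly_square_def)
  have A: "A \<in> carrier_mat 4 4" and sym: "transpose_mat A = A"
    using AG by (auto simp: sym_mats_def)
  have arc: "A $$ (u - 1, v - 1) \<noteq> 0 \<longleftrightarrow> (u, v) \<in> parcs G"
    if "u \<in> {1..4}" "v \<in> {1..4}" "u \<noteq> v" for u v
  proof -
    have "u - 1 < 4" "v - 1 < 4" "u - 1 \<noteq> v - 1" "Suc (u - 1) = u" "Suc (v - 1) = v"
      using that by auto
    then show ?thesis
      using AG by (fastforce simp: sym_mats_def)
  qed
  have deg: "degree (char_poly A) = 4" "coeff (char_poly A) 4 = 1"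
    using degree_monic_char_poly[OF A] by auto
  then have "g \<noteq> 0"
    by (auto simp: g)
  with deg have "degree g = 2"
    by (simp add: g power2_eq_square degree_mult_eq)
  define a b c where "a = coeff g 2" and "b = coeff g 1" and "c = coeff g 0"
  have g_eq: "g = [:c, b, a:]"
    using \<open>degree g = 2\<close>
    by (intro poly_eqI) (auto simp: a_def b_def c_def coeff_pCons numeral_2_eq_2 coeff_eq_0 split: nat.split)
  have a: "a \<noteq> 0"
    using \<open>g \<noteq> 0\<close> \<open>degree g = 2\<close> leading_coeff_neq_0[of g] by (simp add: a_def)
  define u v where "u = i - 1" and "v = j - 1"
  have uv: "u < 4" "v < 4" "u \<noteq> v"
    using verts ij(1) by (auto simp: u_def v_def)
  have "mat_eval A g = 0\<^sub>m 4 4"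
    using symmetric_char_poly_square[OF A sym g] .
  moreover have "mat_eval A g = c \<cdot>\<^sub>m 1\<^sub>m 4 + (b \<cdot>\<^sub>m A + a \<cdot>\<^sub>m (A * A))"
  proof -
    have "a \<cdot>\<^sub>m 1\<^sub>m 4 + A * 0\<^sub>m 4 4 = a \<cdot>\<^sub>m 1\<^sub>m 4"
      using A by (intro eq_matI) auto
    moreover have "A * (b \<cdot>\<^sub>m 1\<^sub>m 4 + A * (a \<cdot>\<^sub>m 1\<^sub>m 4)) = b \<cdot>\<^sub>m A + a \<cdot>\<^sub>m (A * A)"
      using A by (simp add: mult_add_distrib_mat[of _ 4 4 _ 4] mult_smult_distrib[of _ 4 4 _ 4])
    ultimately show ?thesis
      by (simp add: g_eq mat_eval_pCons[OF A] mat_eval_0[OF A])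
  qed
  ultimately have "(c \<cdot>\<^sub>m 1\<^sub>m 4 + (b \<cdot>\<^sub>m A + a \<cdot>\<^sub>m (A * A))) $$ (u, v) = 0"
    using uv by simp
  then have "b * A $$ (u, v) + a * (A * A) $$ (u, v) = 0"
    using A uv by simp
  moreover have "A $$ (u, v) = 0"
    using arc[OF verts(1,2) ij(1)] ij(2) by (simp add: u_def v_def)
  ultimately have "(A * A) $$ (u, v) = 0"
    using a by simp
  moreover have "(A * A) $$ (u, v) = (\<Sum>l = 0..<4. A $$ (u, l) * A $$ (l, v))"
    using A uv by (simp add: scalar_prod_def)
  moreover have "(\<Sum>l = 0..<4. A $$ (u, l) * A $$ (l, v)) = A $$ (u, k - 1) * A $$ (k - 1, v)"
  proof -
    have "A $$ (u, l) * A $$ (l, v) = 0" if l: "l < 4" "l \<noteq> k - 1" for l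
    proof (cases "l = u \<or> l = v")
      \<comment> \<open>Such a term contains an unrestricted diagonal entry; its other factor is the
        zero at (u, v).\<close>
      case True
      then show ?thesis using \<open>A $$ (u, v) = 0\<close> by auto
    next
      case False
      have "\<not> ((i, Suc l) \<in> parcs G \<and> (Suc l, j) \<in> parcs G)"
        using k[of "Suc l"] l verts by auto
      moreover have "Suc l \<noteq> i" "Suc l \<noteq> j" "Suc l \<in> {1..4}"
        using False l by (auto simp: u_def v_def)
      ultimately show ?thesis
        using arc[of i "Suc l"] arc[of "Suc l" j] verts by (auto simp: u_def v_def)
    qed
    then have "(\<Sum>l = 0..<4. A $$ (u, l) * A $$ (l, v)) = (\<Sum>l\<in>{k - 1}. A $$ (u, l) * A $$ (l, v))"
      using verts by (intro sum.mono_neutral_right) auto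
    then show ?thesis by simp
  qed
  moreover have "A $$ (u, k - 1) \<noteq> 0" "A $$ (k - 1, v) \<noteq> 0"
  proof -
    have "(i, k) \<in> parcs G" "(k, j) \<in> parcs G"
      using k by auto
    \<comment> \<open>If k were i or j, one of the two arcs just found would be (i, j). Off the
      diagonal, arcs then force nonzero entries.\<close>
    moreover have "i \<noteq> k" "k \<noteq> j"
      using k ij calculation by metis+
    ultimately show "A $$ (u, k - 1) \<noteq> 0" "A $$ (k - 1, v) \<noteq> 0"
      using arc verts by (auto simp: u_def v_def)
  qed
  ultimately show False by simp
qed

text \<open>The permutation is applied to the rows, and after transposing to the rows again. Each
  pass contributes the sign of p, and the two signs multiply to 1.\<close>

lemma char_poly_permute:
  fixes A :: "'a :: comm_ring_1 mat"
  assumes A: "A \<in> carrier_mat n n" and p: "p permutes {0..<n}"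
  shows "char_poly (mat n n (\<lambda>(i, j). A $$ (p i, p j))) = char_poly A"
proof -
  let ?M = "char_poly_matrix A"
  let ?R = "mat n n (\<lambda>(i, j). ?M $$ (p i, j))"
  have M: "?M \<in> carrier_mat n n" using A by simp
  have lt: "p i < n" if "i < n" for i
    using permutes_in_image[OF p, of i] that by simp
  have inj: "p i = p j \<longleftrightarrow> i = j" for i j
    using permutes_inj[OF p] by (auto dest: injD)
  have "char_poly_matrix (mat n n (\<lambda>(i, j). A $$ (p i, p j))) =
      transpose_mat (mat n n (\<lambda>(i, j). transpose_mat ?R $$ (p i, j)))"
    using A lt inj by (intro eq_matI) (auto simp: char_poly_matrix_def)
  then have "char_poly (mat n n (\<lambda>(i, j). A $$ (p i, p j))) =
      det (mat n n (\<lambda>(i, j). transpose_mat ?R $$ (p i, j)))"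
    by (simp add: char_poly_def det_transpose[of _ n])
  also have "\<dots> = signof p * det (transpose_mat ?R)"
    by (rule det_permute_rows[OF _ p]) simp
  also have "det (transpose_mat ?R) = signof p * det ?M"
    by (simp add: det_transpose[of _ n] det_permute_rows[OF M p])
  finally show ?thesis
    by (simp add: char_poly_def sign_def)
qed

lemma allows_char_poly_square_iso:
  assumes G: "G \<in> simple_graphs n" and H: "H \<in> simple_graphs n"
    and iso: "graph_iso G H" and "allows_char_poly_square n H"
  shows "allows_char_poly_square n G"
proof -
  obtain A g where AH: "A \<in> sym_mats n H" and g: "char_poly A = g\<^sup>2"
    using assms(4) by (auto simp: allows_char_poly_square_def)
  have A: "A \<in> carrier_mat n n" and sym: "transpose_mat A = A"
    and arcs: "\<And>i j. i < n \<Longrightarrow> j < n \<Longrightarrow> i \<noteq> j \<Longrightarrow> A $$ (i, j) \<noteq> 0 \<longleftrightarrow> (Suc i, Suc j) \<in> parcs H"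
    using AH by (auto simp: sym_mats_def)
  obtain f where f: "iso_map n f G H"
    using iso graph_iso_iff[OF G H] by blast
  \<comment> \<open>This is f moved to indices starting at 0; the truncated subtraction is harmless
    because f takes values from 1 on. Outside the range p is the identity, as
    \<open>permutes\<close> demands.\<close>
  define p where "p i = (if i < n then f (Suc i) - 1 else i)" for i
  have f_in: "f (Suc i) \<in> {1..n}" if "i < n" for i
    using bij_betwE[OF iso_map_bij[OF f]] that by simp
  then have Suc_p: "Suc (p i) = f (Suc i)" if "i < n" for i
    using that by (fastforce simp: p_def)
  have p_lt: "p i < n" if "i < n" for i
    using f_in[OF that] Suc_p[OF that] by simp
  have inj: "i = j" if "i < n" "j < n" "p i = p j" for i j
  proof -
    have "f (Suc i) = f (Suc j)"
      using Suc_p that by metis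
    then show ?thesis
      using bij_betw_imp_inj_on[OF iso_map_bij[OF f]] that by (auto dest!: inj_onD)
  qed
  have "inj_on p {0..<n}" "p ` {0..<n} \<subseteq> {0..<n}"
    using inj p_lt by (auto intro: inj_onI)
  then have "bij_betw p {0..<n} {0..<n}"
    by (simp add: bij_betw_def endo_inj_surj)
  then have p: "p permutes {0..<n}"
    by (rule bij_imp_permutes) (simp add: p_def)
  define B where "B = mat n n (\<lambda>(i, j). A $$ (p i, p j))"
  have "A $$ (p j, p i) = A $$ (p i, p j)" if "i < n" "j < n" for i j
    using arg_cong[OF sym, of "\<lambda>X. X $$ (p i, p j)"] A p_lt that by simp
  then have "transpose_mat B = B"
    by (intro eq_matI) (auto simp: B_def)
  moreover have "B $$ (i, j) \<noteq> 0 \<longleftrightarrow> (Suc i, Suc j) \<in> parcs G" if "i < n" "j < n" "i \<noteq> j" for i j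
    using arcs[OF p_lt p_lt, of i j] inj[of i j] iso_map_arc[OF f, of "Suc i" "Suc j"] that
    by (auto simp: B_def Suc_p)
  ultimately have "B \<in> sym_mats n G"
    by (auto simp: sym_mats_def B_def)
  moreover have "char_poly B = g\<^sup>2"
    using char_poly_permute[OF A p] g by (simp add: B_def)
  ultimately show ?thesis
    by (auto simp: allows_char_poly_square_def)
qed

section \<open>Characteristic polynomials of explicit 4 by 4 matrices\<close>

lemma det_3:
  fixes A :: "'a :: comm_ring_1 mat"
  assumes A: "A \<in> carrier_mat 3 3"
  shows "det A = A $$ (0,0) * (A $$ (1,1) * A $$ (2,2) - A $$ (1,2) * A $$ (2,1))
    - A $$ (0,1) * (A $$ (1,0) * A $$ (2,2) - A $$ (1,2) * A $$ (2,0))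
    + A $$ (0,2) * (A $$ (1,0) * A $$ (2,1) - A $$ (1,1) * A $$ (2,0))"
proof -
  have d2: "det B = B $$ (0,0) * B $$ (1,1) - B $$ (0,1) * B $$ (1,0)" if B: "B \<in> carrier_mat 2 2" for B :: "'a mat"
  proof -
    have "det B = (\<Sum>j<2. B $$ (0, j) * cofactor B 0 j)"
      by (rule laplace_expansion_row[OF B]) simp
    then show ?thesis
      using B by (simp add: cofactor_def det_single mat_delete_def numeral_2_eq_2)
  qed
  have "det A = (\<Sum>j<3. A $$ (0, j) * cofactor A 0 j)"
    by (rule laplace_expansion_row[OF A]) simp
  moreover have "mat_delete A 0 j \<in> carrier_mat 2 2" for j
    using A by (simp add: mat_delete_def)
  ultimately show ?thesis
    using A by (simp add: cofactor_def d2 numeral_3_eq_3) (simp add: mat_delete_def numeral_2_eq_2 algebra_simps)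
qed

lemma det_4:
  fixes A :: "'a :: comm_ring_1 mat"
  assumes A: "A \<in> carrier_mat 4 4"
  shows "det A =
      A $$ (0,0) * (A $$ (1,1) * (A $$ (2,2) * A $$ (3,3) - A $$ (2,3) * A $$ (3,2))
        - A $$ (1,2) * (A $$ (2,1) * A $$ (3,3) - A $$ (2,3) * A $$ (3,1))
        + A $$ (1,3) * (A $$ (2,1) * A $$ (3,2) - A $$ (2,2) * A $$ (3,1)))
    - A $$ (0,1) * (A $$ (1,0) * (A $$ (2,2) * A $$ (3,3) - A $$ (2,3) * A $$ (3,2))
        - A $$ (1,2) * (A $$ (2,0) * A $$ (3,3) - A $$ (2,3) * A $$ (3,0))
        + A $$ (1,3) * (A $$ (2,0) * A $$ (3,2) - A $$ (2,2) * A $$ (3,0)))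
    + A $$ (0,2) * (A $$ (1,0) * (A $$ (2,1) * A $$ (3,3) - A $$ (2,3) * A $$ (3,1))
        - A $$ (1,1) * (A $$ (2,0) * A $$ (3,3) - A $$ (2,3) * A $$ (3,0))
        + A $$ (1,3) * (A $$ (2,0) * A $$ (3,1) - A $$ (2,1) * A $$ (3,0)))
    - A $$ (0,3) * (A $$ (1,0) * (A $$ (2,1) * A $$ (3,2) - A $$ (2,2) * A $$ (3,1))
        - A $$ (1,1) * (A $$ (2,0) * A $$ (3,2) - A $$ (2,2) * A $$ (3,0))
        + A $$ (1,2) * (A $$ (2,0) * A $$ (3,1) - A $$ (2,1) * A $$ (3,0)))"
proof -
  have "det A = (\<Sum>j<4. A $$ (0, j) * cofactor A 0 j)"
    by (rule laplace_expansion_row[OF A]) simp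
  also have "\<dots> = A $$ (0,0) * det (mat_delete A 0 0) - A $$ (0,1) * det (mat_delete A 0 1)
      + A $$ (0,2) * det (mat_delete A 0 2) - A $$ (0,3) * det (mat_delete A 0 3)"
    by (simp add: cofactor_def eval_nat_numeral)
  moreover have "mat_delete A 0 j \<in> carrier_mat 3 3" for j
    using A by (simp add: mat_delete_def)
  ultimately show ?thesis
    using A by (simp add: det_3) (simp add: mat_delete_def eval_nat_numeral)
qed

definition mat4 :: "real list list \<Rightarrow> real mat" where
  "mat4 rs = mat 4 4 (\<lambda>(i, j). rs ! i ! j)"

lemma all_less_4: "(\<forall>i<4. P i) \<longleftrightarrow> P 0 \<and> P 1 \<and> P 2 \<and> P (3::nat)"
  by (auto simp: eval_nat_numeral less_Suc_eq)

lemma char_poly_mat4_entry: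
  "i < 4 \<Longrightarrow> j < 4 \<Longrightarrow> char_poly_matrix (mat4 rs) $$ (i, j) = (if i = j then [:0, 1:] else 0) - [:rs ! i ! j:]"
  by (simp add: char_poly_matrix_def mat4_def)

lemma char_poly_mat4:
  "char_poly (mat4 rs) = (let M = (\<lambda>i j. (if i = j then [:0, 1:] else 0) - [:rs ! i ! j:]) in
      M 0 0 * (M 1 1 * (M 2 2 * M 3 3 - M 2 3 * M 3 2) - M 1 2 * (M 2 1 * M 3 3 - M 2 3 * M 3 1)
        + M 1 3 * (M 2 1 * M 3 2 - M 2 2 * M 3 1))
    - M 0 1 * (M 1 0 * (M 2 2 * M 3 3 - M 2 3 * M 3 2) - M 1 2 * (M 2 0 * M 3 3 - M 2 3 * M 3 0)
        + M 1 3 * (M 2 0 * M 3 2 - M 2 2 * M 3 0))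
    + M 0 2 * (M 1 0 * (M 2 1 * M 3 3 - M 2 3 * M 3 1) - M 1 1 * (M 2 0 * M 3 3 - M 2 3 * M 3 0)
        + M 1 3 * (M 2 0 * M 3 1 - M 2 1 * M 3 0))
    - M 0 3 * (M 1 0 * (M 2 1 * M 3 2 - M 2 2 * M 3 1) - M 1 1 * (M 2 0 * M 3 2 - M 2 2 * M 3 0)
        + M 1 2 * (M 2 0 * M 3 1 - M 2 1 * M 3 0)))"
proof -
  have "char_poly_matrix (mat4 rs) \<in> carrier_mat 4 4"
    by (simp add: mat4_def)
  then show ?thesis
    by (simp add: char_poly_def det_4 char_poly_mat4_entry Let_def)
qed

section \<open>The connected graphs on four vertices\<close>

lemma atLeast1_atMost4: "{1..4} = {1, 2, 3, 4::nat}"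
  by auto

lemma ball_1_4: "(\<forall>i\<in>{1..4}. P i) \<longleftrightarrow> P 1 \<and> P 2 \<and> P 3 \<and> P (4::nat)"
  unfolding atLeast1_atMost4 by simp

lemma graph_of_edges_simple:
  assumes "\<And>e. e \<in> E \<Longrightarrow> e \<subseteq> {1..n} \<and> card e = 2"
  shows "graph_of_edges n E \<in> simple_graphs n"
proof -
  have "u \<in> {1..n}" "v \<in> {1..n}" "u \<noteq> v" if "{u, v} \<in> E" for u v
    using assms[OF that] by (auto simp: card_insert_if split: if_splits)
  then show ?thesis
    unfolding simple_graphs_iff
    by (auto simp: graph_of_edges_def insert_commute simp del: atLeastAtMost_iff)
qed

lemma simple_graphs_4:
  "P4 \<in> simple_graphs 4" "K13 \<in> simple_graphs 4" "triangle_pendant \<in> simple_graphs 4"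
  "C4 \<in> simple_graphs 4" "K4_minus_edge \<in> simple_graphs 4" "K4 \<in> simple_graphs 4"
  unfolding P4_def K13_def triangle_pendant_def C4_def K4_minus_edge_def K4_def
  by (rule graph_of_edges_simple; auto)+

lemma parcs_P4: "parcs P4 = {(1,2), (2,1), (2,3), (3,2), (3,4), (4,3)}"
  by (auto simp: P4_def graph_of_edges_def doubleton_eq_iff)

lemma parcs_K13: "parcs K13 = {(1,2), (2,1), (1,3), (3,1), (1,4), (4,1)}"
  by (auto simp: K13_def graph_of_edges_def doubleton_eq_iff)

lemma parcs_triangle_pendant:
  "parcs triangle_pendant = {(1,2), (2,1), (2,3), (3,2), (1,3), (3,1), (3,4), (4,3)}"
  by (auto simp: triangle_pendant_def graph_of_edges_def doubleton_eq_iff)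

lemma parcs_C4: "parcs C4 = {(1,2), (2,1), (2,3), (3,2), (3,4), (4,3), (1,4), (4,1)}"
  by (auto simp: C4_def graph_of_edges_def doubleton_eq_iff)

lemma parcs_K4: "parcs K4 = {(1,2), (2,1), (1,3), (3,1), (1,4), (4,1),
    (2,3), (3,2), (2,4), (4,2), (3,4), (4,3)}" (is "_ = ?A")
proof -
  have "(u, v) \<in> parcs K4 \<longleftrightarrow> u \<in> {1..4} \<and> v \<in> {1..4} \<and> u \<noteq> v" for u v
    by (auto simp: K4_def graph_of_edges_def card_insert_if)
  moreover have "u \<in> {1..4} \<and> v \<in> {1..4} \<and> u \<noteq> v \<longleftrightarrow> (u, v) \<in> ?A" for u v :: nat
    unfolding atLeast1_atMost4 by auto
  ultimately have "(u, v) \<in> parcs K4 \<longleftrightarrow> (u, v) \<in> ?A" for u v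
    by (simp only:)
  then show ?thesis
    unfolding set_eq_iff split_paired_All by blast
qed

lemma parcs_K4_minus_edge: "parcs K4_minus_edge = {(1,3), (3,1), (1,4), (4,1),
    (2,3), (3,2), (2,4), (4,2), (3,4), (4,3)}"
proof -
  have "parcs K4_minus_edge = parcs K4 - {(1, 2), (2, 1)}"
    by (auto simp: K4_def K4_minus_edge_def graph_of_edges_def doubleton_eq_iff)
  then show ?thesis by (simp add: parcs_K4 insert_Diff_if)
qed

lemmas parcs_4 = parcs_P4 parcs_K13 parcs_triangle_pendant parcs_C4 parcs_K4_minus_edge parcs_K4

text \<open>\<open>P4\<close> and \<open>C4\<close> contain the path 1, 2, 3, 4. The other four have
  a vertex adjacent to all others: 1 in \<open>K13\<close> and \<open>K4\<close>, 3 in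
  \<open>triangle_pendant\<close> and \<open>K4_minus_edge\<close>.\<close>

lemma connected_graphs_4:
  "P4 \<in> connected_graphs 4" "K13 \<in> connected_graphs 4" "triangle_pendant \<in> connected_graphs 4"
  "C4 \<in> connected_graphs 4" "K4_minus_edge \<in> connected_graphs 4" "K4 \<in> connected_graphs 4"
proof -
  have path: "G \<in> connected_graphs 4"
    if G: "G \<in> simple_graphs 4" "(1, 2) \<in> parcs G" "(2, 3) \<in> parcs G" "(3, 4) \<in> parcs G" for G
  proof (rule connected_graphsI[OF G(1), of 1])
    have 2: "(1, 2) \<in> (parcs G)\<^sup>*" using G(2) by blast
    with G(3) have 3: "(1, 3) \<in> (parcs G)\<^sup>*" by (rule rtrancl_into_rtrancl[rotated])
    with G(4) have 4: "(1, 4) \<in> (parcs G)\<^sup>*" by (rule rtrancl_into_rtrancl[rotated])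
    show "(1, v) \<in> (parcs G)\<^sup>*" if "v \<in> {1..4}" for v
      using that 2 3 4 unfolding atLeast1_atMost4 by blast
  qed simp
  have star: "G \<in> connected_graphs 4"
    if "G \<in> simple_graphs 4" "r \<in> {1..4}" "\<And>v. v \<in> {1..4} \<Longrightarrow> v \<noteq> r \<Longrightarrow> (r, v) \<in> parcs G" for G r
    using that(1,2)
  proof (rule connected_graphsI)
    show "(r, v) \<in> (parcs G)\<^sup>*" if v: "v \<in> {1..4}" for v
      using \<open>\<And>v. v \<in> {1..4} \<Longrightarrow> v \<noteq> r \<Longrightarrow> (r, v) \<in> parcs G\<close>[OF v] by blast
  qed
  show "P4 \<in> connected_graphs 4" "C4 \<in> connected_graphs 4"
    by (intro path; simp add: simple_graphs_4 parcs_4)+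
  show "K13 \<in> connected_graphs 4" "K4 \<in> connected_graphs 4"
    by (rule star[of _ 1]; auto simp: simple_graphs_4 parcs_4 atLeast1_atMost4)+
  show "triangle_pendant \<in> connected_graphs 4" "K4_minus_edge \<in> connected_graphs 4"
    by (rule star[of _ 3]; auto simp: simple_graphs_4 parcs_4 atLeast1_atMost4)+
qed

text \<open>The vertices w, x, y, z of G play the roles of 1, 2, 3, 4 in H. Symmetry and absence of
  loops reduce the 16 vertex pairs to 6. The map is natural from H to G, hence the inversion at the
  end.\<close>

lemma graph_iso_4I:
  assumes G: "G \<in> simple_graphs 4" and H: "H \<in> simple_graphs 4"
    and wxyz: "distinct [w, x, y, z]" "{w, x, y, z} \<subseteq> {1..4}"
    and arcs: "(w, x) \<in> parcs G \<longleftrightarrow> (1, 2) \<in> parcs H" "(w, y) \<in> parcs G \<longleftrightarrow> (1, 3) \<in> parcs H"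
      "(w, z) \<in> parcs G \<longleftrightarrow> (1, 4) \<in> parcs H" "(x, y) \<in> parcs G \<longleftrightarrow> (2, 3) \<in> parcs H"
      "(x, z) \<in> parcs G \<longleftrightarrow> (2, 4) \<in> parcs H" "(y, z) \<in> parcs G \<longleftrightarrow> (3, 4) \<in> parcs H"
  shows "graph_iso G H"
proof -
  define f where "f i = [w, x, y, z] ! (i - 1)" for i :: nat
  have f: "f 1 = w" "f 2 = x" "f 3 = y" "f 4 = z"
    by (simp_all add: f_def eval_nat_numeral)
  have loop: "(u, u) \<notin> parcs G" "(u, u) \<notin> parcs H" for u
    using G H by (auto simp: simple_graphs_iff)
  have sym: "(u, v) \<in> parcs G \<longleftrightarrow> (v, u) \<in> parcs G" "(u, v) \<in> parcs H \<longleftrightarrow> (v, u) \<in> parcs H" for u v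
    using G H by (auto simp: simple_graphs_iff)
  have "inj_on f {1..4}" "f ` {1..4} \<subseteq> {1..4}"
    using wxyz unfolding atLeast1_atMost4 by (simp_all add: f[unfolded One_nat_def] f inj_on_def)
  then have "bij_betw f {1..4} {1..4}"
    by (simp add: bij_betw_def endo_inj_surj)
  moreover have "\<forall>u\<in>{1..4}. \<forall>v\<in>{1..4}. (u, v) \<in> parcs H \<longleftrightarrow> (f u, f v) \<in> parcs G"
    unfolding ball_1_4 f using arcs loop sym by metis
  ultimately have "iso_map 4 f H G"
    by (simp add: iso_map_def)
  then show ?thesis
    using graph_iso_iff[OF H G] graph_iso_sym[OF H G] by blast
qed

text \<open>By contradiction this is a propositional problem in the six possible edges:
  connectedness gives one clause for each cut, and each labelled copy of a representative is
  excluded by one further clause.\<close>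

lemma connected_graphs_4_classification:
  assumes "G \<in> connected_graphs 4"
  shows "\<exists>H\<in>{P4, K13, triangle_pendant, C4, K4_minus_edge, K4}. graph_iso G H"
proof (rule ccontr)
  assume no: "\<not> ?thesis"
  have G: "G \<in> simple_graphs 4"
    using assms by (simp add: connected_graphs_def)
  define E where "E u v \<longleftrightarrow> (u, v) \<in> parcs G" for u v
  have sym: "E u v \<longleftrightarrow> E v u" for u v
    using G by (auto simp: simple_graphs_iff E_def)
  have flip: "E 2 1 = E 1 2" "E 3 1 = E 1 3" "E 4 1 = E 1 4" "E 3 2 = E 2 3" "E 4 2 = E 2 4" "E 4 3 = E 3 4"
    by (rule sym)+
  have cut: "\<exists>u\<in>S. \<exists>v\<in>{1, 2, 3, 4} - S. E u v"
    if "S \<subseteq> {1, 2, 3, 4}" "a \<in> S" "b \<in> {1, 2, 3, 4} - S" for S a b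
    using connected_graphs_cut[OF assms, of S] that unfolding atLeast1_atMost4 E_def by blast
  \<comment> \<open>One clause for each of the seven splittings of the vertex set into two nonempty
    parts.\<close>
  have cuts: "E 1 2 \<or> E 1 3 \<or> E 1 4" "E 1 2 \<or> E 2 3 \<or> E 2 4" "E 1 3 \<or> E 2 3 \<or> E 3 4"
    "E 1 4 \<or> E 2 4 \<or> E 3 4" "E 1 3 \<or> E 1 4 \<or> E 2 3 \<or> E 2 4" "E 1 2 \<or> E 1 4 \<or> E 2 3 \<or> E 3 4"
    "E 1 2 \<or> E 1 3 \<or> E 2 4 \<or> E 3 4"
    using cut[of "{1}" 1 2] cut[of "{2}" 2 1] cut[of "{3}" 3 1] cut[of "{4}" 4 1]
      cut[of "{1, 2}" 1 3] cut[of "{1, 3}" 1 2] cut[of "{1, 4}" 1 2] flip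
    by (auto simp: insert_Diff_if)
  have no_match: "\<not> ((E w x \<longleftrightarrow> (1, 2) \<in> parcs H) \<and> (E w y \<longleftrightarrow> (1, 3) \<in> parcs H) \<and>
      (E w z \<longleftrightarrow> (1, 4) \<in> parcs H) \<and> (E x y \<longleftrightarrow> (2, 3) \<in> parcs H) \<and>
      (E x z \<longleftrightarrow> (2, 4) \<in> parcs H) \<and> (E y z \<longleftrightarrow> (3, 4) \<in> parcs H))"
    if "H \<in> {P4, K13, triangle_pendant, C4, K4_minus_edge, K4}"
      "distinct [w, x, y, z]" "{w, x, y, z} \<subseteq> {1, 2, 3, 4}" for H w x y z
  proof -
    have "H \<in> simple_graphs 4" "\<not> graph_iso G H"
      using that(1) simple_graphs_4 no by blast+
    then show ?thesis
      using graph_iso_4I[OF G _ that(2), of H] that(3) unfolding atLeast1_atMost4 E_def by argo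
  qed
  \<comment> \<open>Labellings that differ by an automorphism of H give the same clause, so 24 /
    |Aut H| instances suffice: 12, 4, 12, 3, 6 and 1 in this order.\<close>
  have not_P4: "\<not> (E w x \<and> \<not> E w y \<and> \<not> E w z \<and> E x y \<and> \<not> E x z \<and> E y z)"
    and not_K13: "\<not> (E w x \<and> E w y \<and> E w z \<and> \<not> E x y \<and> \<not> E x z \<and> \<not> E y z)"
    and not_paw: "\<not> (E w x \<and> E w y \<and> \<not> E w z \<and> E x y \<and> \<not> E x z \<and> E y z)"
    and not_C4: "\<not> (E w x \<and> \<not> E w y \<and> E w z \<and> E x y \<and> \<not> E x z \<and> E y z)"
    and not_diamond: "\<not> (\<not> E w x \<and> E w y \<and> E w z \<and> E x y \<and> E x z \<and> E y z)"
    and not_K4: "\<not> (E w x \<and> E w y \<and> E w z \<and> E x y \<and> E x z \<and> E y z)"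
    if "distinct [w, x, y, z]" "{w, x, y, z} \<subseteq> {1, 2, 3, 4}" for w x y z
    using no_match[OF _ that, of P4] no_match[OF _ that, of K13] no_match[OF _ that, of triangle_pendant]
      no_match[OF _ that, of C4] no_match[OF _ that, of K4_minus_edge] no_match[OF _ that, of K4]
    by (simp_all add: parcs_4)
  \<comment> \<open>One instance for each of the 38 connected graphs with vertices 1, 2, 3, 4.\<close>
  show False
    using not_P4[of 1 2 3 4] not_P4[of 1 2 4 3] not_P4[of 1 3 2 4] not_P4[of 1 3 4 2]
      not_P4[of 1 4 2 3] not_P4[of 1 4 3 2] not_P4[of 2 1 3 4] not_P4[of 2 1 4 3]
      not_P4[of 2 3 1 4] not_P4[of 2 4 1 3] not_P4[of 3 1 2 4] not_P4[of 3 2 1 4]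
      not_K13[of 1 2 3 4] not_K13[of 2 1 3 4] not_K13[of 3 1 2 4] not_K13[of 4 1 2 3]
      not_paw[of 1 2 3 4] not_paw[of 1 2 4 3] not_paw[of 1 3 2 4] not_paw[of 1 3 4 2]
      not_paw[of 1 4 2 3] not_paw[of 1 4 3 2] not_paw[of 2 3 1 4] not_paw[of 2 3 4 1]
      not_paw[of 2 4 1 3] not_paw[of 2 4 3 1] not_paw[of 3 4 1 2] not_paw[of 3 4 2 1]
      not_C4[of 1 2 3 4] not_C4[of 1 2 4 3] not_C4[of 1 3 2 4]
      not_diamond[of 1 2 3 4] not_diamond[of 1 3 2 4] not_diamond[of 1 4 2 3] not_diamond[of 2 3 1 4]
      not_diamond[of 2 4 1 3] not_diamond[of 3 4 1 2]
      not_K4[of 1 2 3 4]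
    by (simp add: flip[unfolded One_nat_def]) (use cuts[unfolded One_nat_def] in argo)
qed

lemma dominated_4:
  "\<not> dominated 4 P4" "dominated 4 K13" "dominated 4 triangle_pendant"
  "\<not> dominated 4 C4" "dominated 4 K4_minus_edge" "dominated 4 K4"
  unfolding dominated_def atLeast1_atMost4 by (simp_all add: parcs_4)

section \<open>Witnesses for three graphs, and the obstruction in the other three\<close>

lemma allows_C4: "allows_char_poly_square 4 C4"
proof -
  \<comment> \<open>A signed adjacency matrix with orthogonal rows: its square is 2 I and its trace is 0.\<close>
  let ?A = "mat4 [[0, 1, 0, -1], [1, 0, 1, 0], [0, 1, 0, 1], [-1, 0, 1, 0]]"
  have "?A \<in> sym_mats 4 C4"
    unfolding sym_mats_def all_less_4
    by (auto simp: parcs_4 mat4_def eval_nat_numeral less_Suc_eq intro!: eq_matI)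
  moreover have "char_poly ?A = [:-2, 0, 1:]\<^sup>2"
    unfolding char_poly_mat4 by (simp add: Let_def power2_eq_square eval_nat_numeral)
  ultimately show ?thesis
    unfolding allows_char_poly_square_def by blast
qed

lemma allows_K4_minus_edge: "allows_char_poly_square 4 K4_minus_edge"
proof -
  \<comment> \<open>The Gram matrix of (5,0), (0,1), (2,4), (2,-4), the rows of a 4 by 2 matrix M with
    \<open>M\<^sup>T M = 33 I\<close>: the eigenvalues are 33, 33, 0, 0.\<close>
  let ?A = "mat4 [[25, 0, 10, 10], [0, 1, 4, -4], [10, 4, 20, -12], [10, -4, -12, 20]]"
  have "?A \<in> sym_mats 4 K4_minus_edge"
    unfolding sym_mats_def all_less_4
    by (auto simp: parcs_4 mat4_def eval_nat_numeral less_Suc_eq intro!: eq_matI)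
  moreover have "char_poly ?A = [:0, -33, 1:]\<^sup>2"
    unfolding char_poly_mat4 by (simp add: Let_def power2_eq_square eval_nat_numeral)
  ultimately show ?thesis
    unfolding allows_char_poly_square_def by blast
qed

lemma allows_K4: "allows_char_poly_square 4 K4"
proof -
  \<comment> \<open>Sylvester's Hadamard matrix, of trace 0 and square 4 I.\<close>
  let ?A = "mat4 [[1, 1, 1, 1], [1, -1, 1, -1], [1, 1, -1, -1], [1, -1, -1, 1]]"
  have "?A \<in> sym_mats 4 K4"
    unfolding sym_mats_def all_less_4
    by (auto simp: parcs_4 mat4_def eval_nat_numeral less_Suc_eq intro!: eq_matI)
  moreover have "char_poly ?A = [:-4, 0, 1:]\<^sup>2"
    unfolding char_poly_mat4 by (simp add: Let_def power2_eq_square eval_nat_numeral)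
  ultimately show ?thesis
    unfolding allows_char_poly_square_def by blast
qed

text \<open>The numbers are a non-adjacent pair followed by its only common neighbour; likewise in
  the next two lemmas.\<close>

lemma not_allows_P4: "\<not> allows_char_poly_square 4 P4"
  by (rule not_allows_char_poly_square[of _ 1 3 2]) (auto simp: simple_graphs_4 parcs_4)

lemma not_allows_K13: "\<not> allows_char_poly_square 4 K13"
  by (rule not_allows_char_poly_square[of _ 2 3 1]) (auto simp: simple_graphs_4 parcs_4)

lemma not_allows_triangle_pendant: "\<not> allows_char_poly_square 4 triangle_pendant"
  by (rule not_allows_char_poly_square[of _ 1 4 3]) (auto simp: simple_graphs_4 parcs_4)

theorem mainTheorem4:
  shows "card (connected_graphs 4 // iso_rel 4) = 6 \<and>
    {P4, K13, triangle_pendant, C4, K4_minus_edge, K4} \<subseteq> connected_graphs 4 \<and>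
    connected_graphs 4 // iso_rel 4 =
      {iso_rel 4 `` {P4}, iso_rel 4 `` {K13}, iso_rel 4 `` {triangle_pendant},
       iso_rel 4 `` {C4}, iso_rel 4 `` {K4_minus_edge}, iso_rel 4 `` {K4}} \<and>
    (\<forall>H \<in> {P4, K13, triangle_pendant}. \<forall>G \<in> simple_graphs 4.
       graph_iso G H \<longrightarrow> \<not> allows_char_poly_square 4 G) \<and>
    (\<forall>H \<in> {C4, K4_minus_edge, K4}. \<forall>G \<in> simple_graphs 4.
       graph_iso G H \<longrightarrow> allows_char_poly_square 4 G)"
proof -
  let ?R = "{P4, K13, triangle_pendant, C4, K4_minus_edge, K4}"
  let ?cl = "\<lambda>H. iso_rel 4 `` {H}"
  have R: "?R \<subseteq> connected_graphs 4"
    by (simp add: connected_graphs_4)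
  have cls: "connected_graphs 4 // iso_rel 4 = ?cl ` ?R"
  proof
    show "?cl ` ?R \<subseteq> connected_graphs 4 // iso_rel 4"
      using R by (auto intro: quotientI)
    show "connected_graphs 4 // iso_rel 4 \<subseteq> ?cl ` ?R"
    proof
      fix X assume "X \<in> connected_graphs 4 // iso_rel 4"
      then obtain G where G: "G \<in> connected_graphs 4" "X = ?cl G"
        by (auto elim: quotientE)
      obtain H where H: "H \<in> ?R" "graph_iso G H"
        using connected_graphs_4_classification[OF G(1)] by blast
      then have "(G, H) \<in> iso_rel 4"
        using G(1) R by (auto simp: iso_rel_def)
      then have "X = ?cl H"
        using G(2) equiv_class_eq[OF equiv_iso_rel] by simp
      then show "X \<in> ?cl ` ?R" using H(1) by blast
    qed
  qed
  define shape where "shape H = (card (parcs H), dominated 4 H)" for H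
  have shape: "shape P4 = (6, False)" "shape K13 = (6, True)" "shape triangle_pendant = (8, True)"
    "shape C4 = (8, False)" "shape K4_minus_edge = (10, True)" "shape K4 = (12, True)"
    by (simp_all add: shape_def dominated_4 parcs_4)
  \<comment> \<open>The six values of \<open>shape\<close> are distinct while the list has at most
    six graphs. This count gives both that the graphs differ and that \<open>shape\<close> is
    injective on them, with no pairwise comparison.\<close>
  have "card (shape ` ?R) = 6"
    by (simp add: shape)
  moreover have "card ?R \<le> 6"
    using card_length[of "[P4, K13, triangle_pendant, C4, K4_minus_edge, K4]"] by simp
  moreover have "card (shape ` ?R) \<le> card ?R"
    by (rule card_image_le) simp
  ultimately have card: "card ?R = 6" and "card (shape ` ?R) = card ?R"
    by linarith+
  then have inj: "inj_on shape ?R"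
    by (intro eq_card_imp_inj_on) (simp_all only: finite.intros)
  have "inj_on ?cl ?R"
  proof (rule inj_onI)
    fix G H assume GH: "G \<in> ?R" "H \<in> ?R" "?cl G = ?cl H"
    then have c: "G \<in> connected_graphs 4" "H \<in> connected_graphs 4"
      using R by blast+
    then have "(G, H) \<in> iso_rel 4"
      using GH(3) eq_equiv_class_iff[OF equiv_iso_rel] by blast
    then have iso: "graph_iso G H" and s: "G \<in> simple_graphs 4" "H \<in> simple_graphs 4"
      using c by (auto simp: iso_rel_def connected_graphs_def)
    have "shape G = shape H"
      using graph_iso_card_parcs[OF s iso] graph_iso_dominated[OF s iso]
        graph_iso_dominated[OF s(2,1) graph_iso_sym[OF s iso]]
      by (auto simp: shape_def)
    with inj GH(1,2) show "G = H" by (simp only: inj_onD)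
  qed
  then have "card (?cl ` ?R) = 6"
    using card by (simp only: card_image)
  moreover have "\<not> allows_char_poly_square 4 G"
    if "H \<in> {P4, K13, triangle_pendant}" "G \<in> simple_graphs 4" "graph_iso G H" for G H
  proof
    have H: "H \<in> simple_graphs 4" "\<not> allows_char_poly_square 4 H"
      using that(1) simple_graphs_4 not_allows_P4 not_allows_K13 not_allows_triangle_pendant by auto
    \<comment> \<open>The transfer lemma moves a matrix from the target of an isomorphism to its
      source, so the isomorphism is reversed to reach H.\<close>
    assume "allows_char_poly_square 4 G"
    then show False
      using allows_char_poly_square_iso[OF H(1) that(2) graph_iso_sym[OF that(2) H(1) that(3)]] H(2)
      by blast
  qed
  moreover have "allows_char_poly_square 4 G"
    if "H \<in> {C4, K4_minus_edge, K4}" "G \<in> simple_graphs 4" "graph_iso G H" for G H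
  proof -
    have H: "H \<in> simple_graphs 4" "allows_char_poly_square 4 H"
      using that(1) simple_graphs_4 allows_C4 allows_K4_minus_edge allows_K4 by auto
    show ?thesis
      by (rule allows_char_poly_square_iso[OF that(2) H(1) that(3) H(2)])
  qed
  ultimately show ?thesis
    using R by (simp only: cls image_insert image_empty) blast
qed

end
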